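(* Let $F$ be a Ferrers diagram, let $(x,y)\in F$, and let $D$ be an effective divisor on $R(F)$. If \[ \deg(D) < \min\{\, \vert U(x,y)\vert - y,\ \vert L(x,y)\vert - x \,\}, \] then $D$ does not have positive rank.
   Context: $\mathbb{N}=\{1,2,3,\dots\}$. A Ferrers diagram is a finite subset $F\subset\mathbb{N}^2$ such that whenever $(x,y)\in F$, either $x=1$ or $(x-1,y)\in F$, and either $y=1$ or $(x,y-1)\in F$; $x$ is the column index and $y$ the row index. The Ferrers rook graph $R(F)$ is the simple graph with vertex set $F$ in which distinct $(x,y),(x',y')$ are adjacent iff $x=x'$ or $y=y'$. For $(x,y)\in F$: $L(x,y)=\{(x',y')\in F : x'\le x\}$ and $U(x,y)=\{(x',y')\in F : y'\le y\}$. Divisors on a graph: functions $D:V\to\mathbb{Z}$, degree $\sum_v D(v)$, effective if all values are $\ge0$; firing a vertex $v$ means $v$ loses $\deg(v)$ chips and each neighbor gains one; divisors are equivalent if related by a sequence of firings; $\vert D\vert$ is the set of effective divisors equivalent to $D$; $D$ has positive rank if for every vertex $v$ some $D'\in\vert D\vert$ has $D'(v)>0$. *)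

theory Defs
  imports Main
begin

type_synonym cell = "nat \<times> nat"

definition ferrers :: "cell set \<Rightarrow> bool" where
  "ferrers F \<longleftrightarrow> finite F \<and>
     (\<forall>(x,y)\<in>F. x \<ge> 1 \<and> y \<ge> 1 \<and>
        (x = 1 \<or> (x - 1, y) \<in> F) \<and> (y = 1 \<or> (x, y - 1) \<in> F))"

definition rook_adj :: "cell \<Rightarrow> cell \<Rightarrow> bool" where
  "rook_adj v w \<longleftrightarrow> v \<noteq> w \<and> (fst v = fst w \<or> snd v = snd w)"

definition rook_deg :: "cell set \<Rightarrow> cell \<Rightarrow> nat" where
  "rook_deg F v = card {w\<in>F. rook_adj v w}"

definition Lset :: "cell set \<Rightarrow> nat \<Rightarrow> nat \<Rightarrow> cell set" where
  "Lset F x y = {(x', y') \<in> F. x' \<le> x}"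

definition Uset :: "cell set \<Rightarrow> nat \<Rightarrow> nat \<Rightarrow> cell set" where
  "Uset F x y = {(x', y') \<in> F. y' \<le> y}"

text \<open>Divisors on R(F): integer functions; only their values on F matter.\<close>
type_synonym divisor = "cell \<Rightarrow> int"

definition div_deg :: "cell set \<Rightarrow> divisor \<Rightarrow> int" where
  "div_deg F D = (\<Sum>v\<in>F. D v)"

definition effective :: "cell set \<Rightarrow> divisor \<Rightarrow> bool" where
  "effective F D \<longleftrightarrow> (\<forall>v\<in>F. D v \<ge> 0)"

definition fire :: "cell set \<Rightarrow> cell \<Rightarrow> divisor \<Rightarrow> divisor" where
  "fire F v D = (\<lambda>w. if w = v then D w - int (rook_deg F v)
                      else if w \<in> F \<and> rook_adj v w then D w + 1 else D w)"

definition fire_step :: "cell set \<Rightarrow> divisor \<Rightarrow> divisor \<Rightarrow> bool" where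
  "fire_step F D D' \<longleftrightarrow> (\<exists>v\<in>F. D' = fire F v D)"

definition div_equiv :: "cell set \<Rightarrow> divisor \<Rightarrow> divisor \<Rightarrow> bool" where
  "div_equiv F D D' \<longleftrightarrow> (fire_step F)\<^sup>*\<^sup>* D D'"

definition linear_system :: "cell set \<Rightarrow> divisor \<Rightarrow> divisor set" where
  "linear_system F D = {D'. div_equiv F D D' \<and> effective F D'}"

definition positive_rank :: "cell set \<Rightarrow> divisor \<Rightarrow> bool" where
  "positive_rank F D \<longleftrightarrow> (\<forall>v\<in>F. \<exists>D'\<in>linear_system F D. D' v > 0)"

end

theory Submission
  imports Defs
begin

text \<open>
  Call a row or column with \<open>n\<close> cells poor for an effective divisor if it carries at most
  \<open>n - 2\<close> chips. By pigeonhole every effective divisor of the given degree has a poor row of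
  index at most \<open>y\<close> and a poor column of index at most \<open>x\<close>, and these two always cross.
  If a set \<open>S\<close> can be fired legally, then every line that \<open>S\<close> cuts properly carries at least
  \<open>k (n - k) \<ge> n - 1\<close> chips both before and after the firing; so poor lines are not cut.
  Hence if \<open>S\<close> misses a cell of a poor row, it misses that row and the poor column, so no row
  of index at most \<open>y\<close> lies inside \<open>S\<close>, and firing \<open>S\<close> makes no row poor.

  Now take an effective divisor in the class with as few poor rows as possible, let \<open>i\<close> be one
  of them, and minimise a potential that decreases strictly whenever a nonempty set avoiding
  row \<open>i\<close> is fired. Row \<open>i\<close> has an empty cell; if some equivalent effective divisor had a chip
  there, the cells where the connecting firing script is maximal would form a nonempty legal
  set avoiding row \<open>i\<close>, contradicting minimality.
\<close>

section \<open>Laplacian and firing scripts\<close>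

text \<open>The sign is chosen so that applying a firing script \<open>g\<close> subtracts
  \<open>laplacian F g\<close> from a divisor.\<close>

definition laplacian :: "cell set \<Rightarrow> (cell \<Rightarrow> int) \<Rightarrow> cell \<Rightarrow> int" where
  "laplacian F g u = (\<Sum>v\<in>F. if rook_adj u v then g u - g v else 0)"

text \<open>Rows arise from \<open>p = snd\<close> and columns from \<open>p = fst\<close>, so both
  are treated at once.\<close>

definition line :: "cell set \<Rightarrow> (cell \<Rightarrow> nat) \<Rightarrow> nat \<Rightarrow> cell set" where
  "line F p k = {u \<in> F. p u = k}"

definition poor :: "divisor \<Rightarrow> cell set \<Rightarrow> bool" where
  "poor E R \<longleftrightarrow> sum E R < int (card R) - 1"

lemma rook_adj_commute: "rook_adj u v \<longleftrightarrow> rook_adj v u"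
  by (auto simp: rook_adj_def)

lemma laplacian_const [simp]: "laplacian F (\<lambda>_. c) u = 0"
  unfolding laplacian_def by (rule sum.neutral) simp

lemma laplacian_add: "laplacian F (\<lambda>u. f u + g u) u = laplacian F f u + laplacian F g u"
  unfolding laplacian_def sum.distrib[symmetric] by (rule sum.cong) auto

lemma laplacian_diff: "laplacian F (\<lambda>u. f u - g u) u = laplacian F f u - laplacian F g u"
  unfolding laplacian_def sum_subtractf[symmetric] by (rule sum.cong) auto

text \<open>Adjacency is symmetric. With \<open>h\<close> constantly 1 this gives conservation of
  degree; with \<open>h\<close> a potential it turns the effect of firing a set into a sum over that
  set.\<close>

lemma laplacian_self_adjoint:
  "(\<Sum>u\<in>F. laplacian F g u * h u) = (\<Sum>u\<in>F. g u * laplacian F h u)"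
proof -
  let ?c = "\<lambda>u v. if rook_adj u v then g u * h v else 0"
  have "(\<Sum>u\<in>F. g u * laplacian F h u) - (\<Sum>u\<in>F. laplacian F g u * h u)
      = (\<Sum>u\<in>F. \<Sum>v\<in>F. ?c v u - ?c u v)"
    unfolding laplacian_def sum_distrib_left sum_distrib_right sum_subtractf[symmetric]
    by (intro sum.cong refl) (auto simp: algebra_simps rook_adj_commute)
  also have "\<dots> = (\<Sum>u\<in>F. \<Sum>v\<in>F. ?c v u) - (\<Sum>u\<in>F. \<Sum>v\<in>F. ?c u v)"
    by (simp add: sum_subtractf)
  also have "(\<Sum>u\<in>F. \<Sum>v\<in>F. ?c v u) = (\<Sum>u\<in>F. \<Sum>v\<in>F. ?c u v)"
    by (rule sum.swap)
  finally show ?thesis by simp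
qed

lemma fire_eq_laplacian:
  assumes "finite F" "v \<in> F" "u \<in> F"
  shows "fire F v D u = D u - laplacian F (\<lambda>w. of_bool (w = v)) u"
proof (cases "u = v")
  case True
  have "laplacian F (\<lambda>w. of_bool (w = v)) u = (\<Sum>w\<in>F. if rook_adj v w then 1 else 0)"
    unfolding laplacian_def True by (rule sum.cong) (auto simp: rook_adj_def)
  also have "\<dots> = int (rook_deg F v)"
    using assms(1) by (simp add: rook_deg_def sum.If_cases Int_def)
  finally show ?thesis using True by (simp add: fire_def)
next
  case False
  have "laplacian F (\<lambda>w. of_bool (w = v)) u
      = (\<Sum>w\<in>F. if w = v then (if rook_adj u v then - 1 else 0) else 0)"
    unfolding laplacian_def using False by (intro sum.cong) auto
  also have "\<dots> = (if rook_adj u v then - 1 else 0)"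
    using assms by simp
  finally show ?thesis using False assms by (simp add: fire_def rook_adj_commute)
qed

lemma div_equiv_imp_script:
  assumes "finite F" "div_equiv F D E"
  shows "\<exists>f. \<forall>u\<in>F. E u = D u - laplacian F f u"
  using assms(2) unfolding div_equiv_def
proof (induction rule: rtranclp_induct)
  case base
  show ?case by (rule exI[of _ "\<lambda>_. 0"]) simp
next
  case (step E E')
  obtain f where f: "\<forall>u\<in>F. E u = D u - laplacian F f u" using step.IH by blast
  obtain v where v: "v \<in> F" "E' = fire F v E" using step.hyps(2) by (auto simp: fire_step_def)
  have "\<forall>u\<in>F. E' u = D u - laplacian F (\<lambda>w. f w + of_bool (w = v)) u"
    unfolding laplacian_add using fire_eq_laplacian[OF assms(1) v(1)] v(2) f
    by simp
  then show ?case by blast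
qed

text \<open>The cells of \<open>S\<close> are fired one at a time; \<open>div_equiv\<close>
  tolerates negative values on the way.\<close>

lemma div_equiv_fire_set:
  assumes "finite F" "S \<subseteq> F"
  shows "\<exists>E'. div_equiv F E E' \<and> (\<forall>u\<in>F. E' u = E u - laplacian F (\<lambda>w. of_bool (w \<in> S)) u)"
proof -
  have "finite S" using assms finite_subset by blast
  then show ?thesis using assms(2)
  proof (induction S rule: finite_induct)
    case empty
    show ?case by (rule exI[of _ E]) (simp add: div_equiv_def)
  next
    case (insert v S)
    then obtain E' where E': "div_equiv F E E'"
      "\<forall>u\<in>F. E' u = E u - laplacian F (\<lambda>w. of_bool (w \<in> S)) u" by blast
    have v: "v \<in> F" using insert by blast
    have "div_equiv F E (fire F v E')"
      using E'(1) v unfolding div_equiv_def fire_step_def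
      by (metis (mono_tags, lifting) rtranclp.rtrancl_into_rtrancl)
    moreover have "(\<lambda>w. of_bool (w \<in> insert v S))
        = (\<lambda>w. of_bool (w \<in> S) + of_bool (w = v) :: int)"
      using insert.hyps by (intro ext) auto
    ultimately show ?case
      using fire_eq_laplacian[OF assms(1) v] E'(2)
      by (intro exI[of _ "fire F v E'"]) (simp add: laplacian_add)
  qed
qed

lemma div_deg_equiv:
  assumes "finite F" "div_equiv F D E"
  shows "div_deg F E = div_deg F D"
proof -
  obtain f where f: "\<forall>u\<in>F. E u = D u - laplacian F f u"
    using div_equiv_imp_script[OF assms] by blast
  have "(\<Sum>u\<in>F. laplacian F f u) = 0"
    using laplacian_self_adjoint[of F f "\<lambda>_. 1"] by simp
  then show ?thesis using f by (simp add: div_deg_def sum_subtractf)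
qed

section \<open>Chip counts on lines\<close>

text \<open>Each cell of \<open>T\<close> contributes at least 1 and no term is negative. An empty
  \<open>T\<close> gives just the sign.\<close>

lemma laplacian_ge_card:
  assumes "finite F" "T \<subseteq> F" "\<And>v. v \<in> T \<Longrightarrow> rook_adj u v \<and> g v \<le> g u - 1"
    "\<And>v. v \<in> F \<Longrightarrow> rook_adj u v \<Longrightarrow> g v \<le> g u"
  shows "int (card T) \<le> laplacian F g u"
proof -
  have "int (card T) \<le> (\<Sum>v\<in>T. if rook_adj u v then g u - g v else 0)"
    using sum_mono[of T "\<lambda>_. 1::int" "\<lambda>v. if rook_adj u v then g u - g v else 0"] assms(3)
    by force
  also have "\<dots> \<le> laplacian F g u"
    unfolding laplacian_def using assms by (intro sum_mono2) auto
  finally show ?thesis .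
qed

lemma laplacian_le_card:
  assumes "finite F" "T \<subseteq> F" "\<And>v. v \<in> T \<Longrightarrow> rook_adj u v \<and> g u + 1 \<le> g v"
    "\<And>v. v \<in> F \<Longrightarrow> rook_adj u v \<Longrightarrow> g u \<le> g v"
  shows "laplacian F g u \<le> - int (card T)"
proof -
  have "laplacian F (\<lambda>v. - g v) u = - laplacian F g u"
    unfolding laplacian_def sum_negf[symmetric] by (rule sum.cong) auto
  then show ?thesis
    using laplacian_ge_card[of F T u "\<lambda>v. - g v"] assms by force
qed

lemma mult_ge_add_minus_one:
  fixes a b :: int
  assumes "1 \<le> a" "1 \<le> b"
  shows "a + b - 1 \<le> a * b"
proof -
  have "0 \<le> (a - 1) * (b - 1)" using assms by simp
  then show ?thesis by (simp add: algebra_simps)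
qed

text \<open>The cells of \<open>A\<close> together carry at least \<open>card A * card B\<close>
  chips, and a product of positive integers is at least their sum minus 1.\<close>

lemma not_poor_if_split:
  assumes "finite R" "A \<union> B = R" "A \<inter> B = {}" "A \<noteq> {}" "B \<noteq> {}"
    "\<And>u. u \<in> R \<Longrightarrow> 0 \<le> E u" "\<And>u. u \<in> A \<Longrightarrow> int (card B) \<le> E u"
  shows "\<not> poor E R"
proof -
  have fin: "finite A" "finite B" using assms by auto
  have "int (card R) = int (card A) + int (card B)"
    using assms fin card_Un_disjoint by (metis of_nat_add)
  moreover have "1 \<le> int (card A)" "1 \<le> int (card B)"
    using assms fin by (simp_all add: Suc_leI card_gt_0_iff)
  ultimately have "int (card R) - 1 \<le> int (card A) * int (card B)"
    using mult_ge_add_minus_one by force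
  also have "\<dots> \<le> sum E A" using assms(7) sum_bounded_below by (metis mult.commute mult_of_nat_commute)
  also have "\<dots> \<le> sum E R" using assms by (intro sum_mono2) auto
  finally show ?thesis by (simp add: poor_def)
qed

lemma poor_has_zero:
  assumes "finite R" "\<And>u. u \<in> R \<Longrightarrow> 0 \<le> E u" "poor E R"
  shows "\<exists>u\<in>R. E u = 0"
proof (rule ccontr)
  assume "\<not> ?thesis"
  then have "\<And>u. u \<in> R \<Longrightarrow> 1 \<le> E u" using assms(2) by force
  then have "int (card R) \<le> sum E R" using sum_bounded_below[of R 1 E] by simp
  then show False using assms(3) by (simp add: poor_def)
qed

text \<open>Otherwise each of the \<open>n\<close> lines carries at least its size minus 1, and
  summing contradicts the degree bound.\<close>

lemma poor_line_exists:
  assumes "finite F" "effective F E" "\<And>u. u \<in> F \<Longrightarrow> 1 \<le> p u"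
    "div_deg F E < int (card {u\<in>F. p u \<le> n}) - int n"
  shows "\<exists>k\<in>{1..n}. poor E (line F p k)"
proof (rule ccontr)
  assume neg: "\<not> ?thesis"
  have un: "{u\<in>F. p u \<le> n} = (\<Union>k\<in>{1..n}. line F p k)"
    using assms(3) by (auto simp: line_def)
  have fin: "\<And>k. finite (line F p k)" using assms(1) by (simp add: line_def)
  have "int (card {u\<in>F. p u \<le> n}) - int n = (\<Sum>k\<in>{1..n}. int (card (line F p k)) - 1)"
    unfolding un by (subst card_UN_disjoint) (use fin in \<open>auto simp: line_def sum_subtractf\<close>)
  also have "\<dots> \<le> (\<Sum>k\<in>{1..n}. sum E (line F p k))"
    using neg by (intro sum_mono) (auto simp: poor_def not_less)
  also have "\<dots> = sum E {u\<in>F. p u \<le> n}"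
    unfolding un by (subst sum.UNION_disjoint) (use fin in \<open>auto simp: line_def\<close>)
  also have "\<dots> \<le> div_deg F E"
    unfolding div_deg_def using assms by (intro sum_mono2) (auto simp: effective_def)
  finally show False using assms(4) by simp
qed

lemma ferrers_down_closed:
  assumes "ferrers F" "(a, b) \<in> F" "1 \<le> a'" "a' \<le> a" "1 \<le> b'" "b' \<le> b"
  shows "(a', b') \<in> F"
proof -
  have x: "(a - 1, b) \<in> F" if "(a, b) \<in> F" "a \<noteq> 1" for a b
    using assms(1) that by (auto simp: ferrers_def)
  have y: "(a, b - 1) \<in> F" if "(a, b) \<in> F" "b \<noteq> 1" for a b
    using assms(1) that by (auto simp: ferrers_def)
  have "(a', b) \<in> F" using assms(4,2)
  proof (induction rule: inc_induct)
    case (step n)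
    then show ?case using x[of "Suc n" b] assms(3) by simp
  qed
  then show ?thesis using assms(6)
  proof (induction rule: inc_induct[OF assms(6)])
    case (2 n)
    then show ?case using y[of a' "Suc n"] assms(5) by simp
  qed
qed

section \<open>Legal set firings and poor lines\<close>

locale legal_firing =
  fixes F S :: "cell set" and E E' :: divisor
  assumes finite_F: "finite F"
    and fired: "\<And>u. u \<in> F \<Longrightarrow> E' u = E u - laplacian F (\<lambda>w. of_bool (w \<in> S)) u"
    and eff: "effective F E" and eff': "effective F E'"
begin

text \<open>A cell of \<open>R \<inter> S\<close> must hold a chip for every cell of
  \<open>R - S\<close>, since \<open>E'\<close> is effective; afterwards a cell of
  \<open>R - S\<close> holds one from every cell of \<open>R \<inter> S\<close>.\<close>

lemma cut_line_not_poor: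
  assumes "R \<subseteq> F" "\<And>u v. u \<in> R \<Longrightarrow> v \<in> R \<Longrightarrow> u \<noteq> v \<Longrightarrow> rook_adj u v"
    "R \<inter> S \<noteq> {}" "R - S \<noteq> {}"
  shows "\<not> poor E R" "\<not> poor E' R"
proof -
  have fin: "finite R" using assms(1) finite_F finite_subset by blast
  have adj: "\<And>u v. u \<in> R \<inter> S \<Longrightarrow> v \<in> R - S \<Longrightarrow> rook_adj u v \<and> rook_adj v u"
    using assms(2) by (metis Diff_iff Int_iff)
  show "\<not> poor E R"
  proof (rule not_poor_if_split[of R "R \<inter> S" "R - S"])
    fix u assume u: "u \<in> R \<inter> S"
    have "int (card (R - S)) \<le> laplacian F (\<lambda>w. of_bool (w \<in> S)) u"
      using finite_F u assms(1) adj by (intro laplacian_ge_card) auto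
    moreover have "0 \<le> E' u" using u assms(1) eff' by (auto simp: effective_def)
    ultimately show "int (card (R - S)) \<le> E u" using fired[of u] u assms(1) by auto
  qed (use fin assms eff in \<open>auto simp: effective_def\<close>)
  show "\<not> poor E' R"
  proof (rule not_poor_if_split[of R "R - S" "R \<inter> S"])
    fix u assume u: "u \<in> R - S"
    have "laplacian F (\<lambda>w. of_bool (w \<in> S)) u \<le> - int (card (R \<inter> S))"
      using finite_F u assms(1) adj by (intro laplacian_le_card) auto
    moreover have "0 \<le> E u" using u assms(1) eff by (auto simp: effective_def)
    ultimately show "int (card (R \<inter> S)) \<le> E' u" using fired[of u] u assms(1) by auto
  qed (use fin assms eff' in \<open>auto simp: effective_def\<close>)
qed

lemma poor_after_imp_poor_before:
  assumes "R \<subseteq> F" "R \<inter> S = {}" "poor E' R"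
  shows "poor E R"
proof -
  have "sum E R \<le> sum E' R"
  proof (rule sum_mono)
    fix u assume u: "u \<in> R"
    have "laplacian F (\<lambda>w. of_bool (w \<in> S)) u \<le> - int (card ({}::cell set))"
      using finite_F u assms by (intro laplacian_le_card) auto
    then show "E u \<le> E' u" using fired[of u] u assms(1) by auto
  qed
  then show ?thesis using assms(3) by (simp add: poor_def)
qed

end

lemma adj_in_line:
  assumes "p = fst \<or> p = snd" "u \<in> line F p k" "v \<in> line F p k" "u \<noteq> v"
  shows "rook_adj u v"
  using assms by (auto simp: rook_adj_def line_def)

lemma poor_rows_shrink:
  assumes "ferrers F" "(x, y) \<in> F" "legal_firing F S E E'"
    "i \<in> {1..y}" "poor E (line F snd i)" "w \<in> line F snd i" "w \<notin> S"
    "j \<in> {1..x}" "poor E (line F fst j)"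
  shows "line F snd i \<inter> S = {}"
    and "{k\<in>{1..y}. poor E' (line F snd k)} \<subseteq> {k\<in>{1..y}. poor E (line F snd k)}"
proof -
  interpret legal_firing F S E E' by fact
  have sub: "line F p k \<subseteq> F" for p k by (auto simp: line_def)
  \<comment> \<open>The rectangle with corner \<open>(x, y)\<close> lies in \<open>F\<close>, so
    column \<open>j\<close> meets each of these rows.\<close>
  have cross: "(j, k) \<in> F" if "k \<in> {1..y}" for k
    using ferrers_down_closed[OF assms(1,2)] that assms(8) by auto
  show row: "line F snd i \<inter> S = {}"
    using cut_line_not_poor(1)[OF sub, of snd i] adj_in_line assms(5-7) by blast
  have "(j, i) \<in> line F snd i" "(j, i) \<in> line F fst j"
    using cross assms(4) by (auto simp: line_def)
  then have col: "line F fst j \<inter> S = {}"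
    using row cut_line_not_poor(1)[OF sub, of fst j] adj_in_line assms(9) by blast
  have "poor E (line F snd k)" if k: "k \<in> {1..y}" "poor E' (line F snd k)" for k
  proof -
    \<comment> \<open>This cell keeps row \<open>k\<close> from lying inside \<open>S\<close>; as a
      row that is poor afterwards is not cut, it avoids \<open>S\<close> and can only have gained
      chips.\<close>
    have "(j, k) \<in> line F snd k - S"
      using cross[OF k(1)] col by (auto simp: line_def)
    then have "line F snd k \<inter> S = {}"
      using cut_line_not_poor(2)[OF sub, of snd k] adj_in_line k(2) by blast
    then show ?thesis using poor_after_imp_poor_before[OF sub] k(2) by blast
  qed
  then show "{k\<in>{1..y}. poor E' (line F snd k)} \<subseteq> {k\<in>{1..y}. poor E (line F snd k)}"
    by blast
qed

section \<open>A potential for firings that avoid a row\<close>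

text \<open>The potential is designed to have positive Laplacian off row \<open>i\<close>: cells in columns
  reaching row \<open>i\<close> see the value 0 there, and the remaining cells see a smaller value in
  column 1.\<close>

definition row_potential :: "cell set \<Rightarrow> nat \<Rightarrow> cell \<Rightarrow> int" where
  "row_potential F i u = (if snd u = i then 0 else
     if (fst u, i) \<in> F then int (card F) else int (card F) + 1)"

text \<open>If column \<open>a\<close> meets row \<open>i\<close>, the drop of \<open>card F\<close>
  at \<open>(a, i)\<close> outweighs the other \<open>card F - 2\<close> cells, each costing at most
  1. If not, \<open>u\<close> has the maximal value and \<open>(1, b)\<close> lies 1 below
  it.\<close>

lemma laplacian_row_potential_pos:
  assumes "ferrers F" "(c, i) \<in> F" "u \<in> F" "snd u \<noteq> i"
  shows "0 < laplacian F (row_potential F i) u"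
proof -
  let ?h = "row_potential F i"
  have fin: "finite F" using assms(1) by (simp add: ferrers_def)
  obtain a b where u: "u = (a, b)" by fastforce
  have ge: "1 \<le> a" "1 \<le> b" "1 \<le> c" "1 \<le> i"
    using assms by (auto simp: ferrers_def u)
  show ?thesis
  proof (cases "(a, i) \<in> F")
    case True
    let ?G = "F - {u} - {(a, i)}"
    have ne: "(a, i) \<noteq> u" using assms(4) u by auto
    have card: "int (card ?G) = int (card F) - 2"
    proof -
      have "card {u, (a,i)} = 2" using ne by auto
      then have "card (F - {u, (a,i)}) = card F - 2" "2 \<le> card F"
        using True assms(3) fin card_Diff_subset[of "{u,(a,i)}" F] card_mono[of F "{u,(a,i)}"] by auto
      moreover have "?G = F - {u, (a,i)}" by auto
      ultimately show ?thesis by simp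
    qed
    let ?t = "\<lambda>v. if rook_adj u v then ?h u - ?h v else 0"
    have "- int (card ?G) \<le> (\<Sum>v\<in>?G. ?t v)"
      using sum_bounded_below[of ?G "-1" ?t] True assms(4) u
      by (simp add: row_potential_def)
    moreover have "laplacian F ?h u = ?t u + (?t (a, i) + (\<Sum>v\<in>?G. ?t v))"
      unfolding laplacian_def using fin True assms(3) ne
      by (simp add: sum.remove[OF fin assms(3)] sum.remove[of "F - {u}" "(a, i)"])
    moreover have "?t u = 0" by (simp add: rook_adj_def)
    moreover have "?t (a, i) = int (card F)"
      using True assms(4) u by (auto simp: row_potential_def rook_adj_def)
    ultimately show ?thesis using card by linarith
  next
    case False
    have "(1, i) \<in> F" using ferrers_down_closed[OF assms(1,2)] ge by simp
    moreover have "(1, b) \<in> F" using ferrers_down_closed[OF assms(1), of a b] assms(3) u ge by simp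
    moreover have "a \<noteq> 1" using False \<open>(1, i) \<in> F\<close> by auto
    ultimately have "int (card {(1::nat, b)}) \<le> laplacian F ?h u"
      using fin False assms(4) u
      by (intro laplacian_ge_card) (auto simp: row_potential_def rook_adj_def)
    then show ?thesis by simp
  qed
qed

lemma row_potential_decreases:
  assumes "ferrers F" "(c, i) \<in> F" "legal_firing F S E E'"
    "S \<subseteq> F" "S \<noteq> {}" "line F snd i \<inter> S = {}"
  shows "(\<Sum>u\<in>F. E' u * row_potential F i u) < (\<Sum>u\<in>F. E u * row_potential F i u)"
proof -
  interpret legal_firing F S E E' by fact
  let ?h = "row_potential F i"
  let ?s = "\<lambda>w. of_bool (w \<in> S) :: int"
  have "(\<Sum>u\<in>F. E u * ?h u) - (\<Sum>u\<in>F. E' u * ?h u) = (\<Sum>u\<in>F. laplacian F ?s u * ?h u)"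
    unfolding sum_subtractf[symmetric] by (rule sum.cong) (auto simp: fired algebra_simps)
  also have "\<dots> = (\<Sum>u\<in>F. ?s u * laplacian F ?h u)"
    by (rule laplacian_self_adjoint)
  also have "\<dots> = (\<Sum>u\<in>S. laplacian F ?h u)"
    using assms(4) finite_F by (intro sum.mono_neutral_cong_right) auto
  also have "\<dots> > 0"
  proof (rule sum_pos)
    show "finite S" using assms(4) finite_F finite_subset by blast
    show "0 < laplacian F ?h u" if "u \<in> S" for u
      using that assms by (intro laplacian_row_potential_pos[OF assms(1,2)]) (auto simp: line_def)
  qed fact
  finally show ?thesis by simp
qed

section \<open>Level sets of firing scripts\<close>

text \<open>\<open>S\<close> is the set where the script \<open>g\<close> from \<open>E\<close> to
  \<open>E1\<close> is maximal. As \<open>g\<close> is integral, it drops by at least 1 on leaving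
  \<open>S\<close>, so on \<open>S\<close> firing costs no more than \<open>g\<close> does and
  \<open>E'\<close> stays above \<open>E1\<close>; off \<open>S\<close> chips are only
  gained.\<close>

lemma legal_firing_towards:
  assumes "finite F" "E \<in> linear_system F D" "E1 \<in> linear_system F D"
    "w \<in> F" "E w = 0" "0 < E1 w"
  shows "\<exists>S E'. S \<subseteq> F \<and> S \<noteq> {} \<and> w \<notin> S \<and> E' \<in> linear_system F D \<and> legal_firing F S E E'"
proof -
  obtain f where f: "\<forall>u\<in>F. E u = D u - laplacian F f u"
    using div_equiv_imp_script assms(1,2) unfolding linear_system_def by blast
  obtain f1 where f1: "\<forall>u\<in>F. E1 u = D u - laplacian F f1 u"
    using div_equiv_imp_script assms(1,3) unfolding linear_system_def by blast
  define g where "g = (\<lambda>u. f1 u - f u)"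
  have g: "E1 u = E u - laplacian F g u" if "u \<in> F" for u
    using f f1 that by (simp add: g_def laplacian_diff)
  define m where "m = Max (g ` F)"
  have max: "g u \<le> m" if "u \<in> F" for u using that assms(1) by (simp add: m_def)
  define S where "S = {u\<in>F. g u = m}"
  have "m \<in> g ` F" unfolding m_def using assms(1,4) by (intro Max_in) auto
  then have S: "S \<subseteq> F" "S \<noteq> {}" by (auto simp: S_def)
  let ?s = "\<lambda>w. of_bool (w \<in> S) :: int"
  have le: "laplacian F ?s u \<le> laplacian F g u" if "u \<in> S" for u
    unfolding laplacian_def
  proof (rule sum_mono)
    fix v assume "v \<in> F"
    then show "(if rook_adj u v then ?s u - ?s v else 0) \<le> (if rook_adj u v then g u - g v else 0)"
      using that max[of v] by (auto simp: S_def)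
  qed
  have nn: "0 \<le> laplacian F ?s u" if "u \<in> S" for u
    using laplacian_ge_card[of F "{}" u ?s] assms(1) that by simp
  have np: "laplacian F ?s u \<le> 0" if "u \<notin> S" for u
    using laplacian_le_card[of F "{}" u ?s] assms(1) that by simp
  obtain E' where E': "div_equiv F E E'" "\<forall>u\<in>F. E' u = E u - laplacian F ?s u"
    using div_equiv_fire_set[OF assms(1) S(1)] by blast
  have eff: "effective F E" "effective F E1" "div_equiv F D E"
    using assms(2,3) by (auto simp: linear_system_def)
  have "0 \<le> E' u" if "u \<in> F" for u
  proof (cases "u \<in> S")
    case True
    then have "E1 u \<le> E' u" using g[OF that] bspec[OF E'(2) that] le[of u] by linarith
    then show ?thesis using eff(2) that by (force simp: effective_def)
  next
    case False
    then have "E u \<le> E' u" using bspec[OF E'(2) that] np[of u] by linarith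
    then show ?thesis using eff(1) that by (force simp: effective_def)
  qed
  then have eff': "effective F E'" by (simp add: effective_def)
  have "E' \<in> linear_system F D"
    using eff' eff(3) E'(1) unfolding linear_system_def div_equiv_def by auto
  \<comment> \<open>On \<open>S\<close> the script \<open>g\<close> cannot add chips, but
    \<open>w\<close> goes from 0 to a positive value.\<close>
  moreover have "w \<notin> S"
    using g[OF assms(4)] le[of w] nn[of w] assms(5,6) by force
  moreover have "legal_firing F S E E'"
    using assms(1) E'(2) eff(1) eff' by unfold_locales auto
  ultimately show ?thesis using S by blast
qed

section \<open>Extremal choice of a divisor\<close>

theorem theorem3p4:
  fixes F :: "(nat \<times> nat) set" and x y :: nat and D :: "(nat \<times> nat) \<Rightarrow> int"
  assumes "ferrers F"
    and "(x, y) \<in> F"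
    and "effective F D"
    and "div_deg F D < min (int (card (Uset F x y)) - int y) (int (card (Lset F x y)) - int x)"
  shows "\<not> positive_rank F D"
proof
  assume rank: "positive_rank F D"
  have fin: "finite F" and ge: "\<And>u. u \<in> F \<Longrightarrow> 1 \<le> fst u" "\<And>u. u \<in> F \<Longrightarrow> 1 \<le> snd u"
    using assms(1) by (auto simp: ferrers_def)
  have UL: "Uset F x y = {u\<in>F. snd u \<le> y}" "Lset F x y = {u\<in>F. fst u \<le> x}"
    by (auto simp: Uset_def Lset_def)
  have poor_row: "\<exists>k\<in>{1..y}. poor E (line F snd k)"
    and poor_col: "\<exists>k\<in>{1..x}. poor E (line F fst k)" if "E \<in> linear_system F D" for E
    using that poor_line_exists[OF fin, of E snd] poor_line_exists[OF fin, of E fst] ge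
      div_deg_equiv[OF fin, of D E] assms(4) unfolding UL linear_system_def by auto
  define rows where "rows E = {k\<in>{1..y}. poor E (line F snd k)}" for E
  have "D \<in> linear_system F D" using assms(3) by (simp add: linear_system_def div_equiv_def)
  then obtain E0 where E0: "E0 \<in> linear_system F D"
    "\<And>E. E \<in> linear_system F D \<Longrightarrow> card (rows E0) \<le> card (rows E)"
    using ex_has_least_nat[of "\<lambda>E. E \<in> linear_system F D" D "\<lambda>E. card (rows E)"] by blast
  obtain i where i: "i \<in> {1..y}" "poor E0 (line F snd i)" using poor_row[OF E0(1)] by blast
  \<comment> \<open>Fixing the whole set of poor rows, not just its size, keeps row \<open>i\<close>
    poor in every competitor.\<close>
  let ?Q = "\<lambda>E. E \<in> linear_system F D \<and> rows E = rows E0"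
  let ?phi = "\<lambda>E. \<Sum>u\<in>F. E u * row_potential F i u"
  obtain E where E: "E \<in> linear_system F D" "rows E = rows E0"
    and least: "\<And>E'. ?Q E' \<Longrightarrow> nat (?phi E) \<le> nat (?phi E')"
    using ex_has_least_nat[of ?Q E0 "\<lambda>E. nat (?phi E)"] E0(1) by blast
  have "i \<in> rows E" using i E(2) by (simp add: rows_def)
  then have poor_i: "poor E (line F snd i)" by (simp add: rows_def)
  have "\<exists>w\<in>line F snd i. E w = 0"
    using poor_i fin E(1)
    by (intro poor_has_zero) (auto simp: line_def linear_system_def effective_def)
  then obtain w where w: "w \<in> line F snd i" "E w = 0" by blast
  then have wF: "w \<in> F" "(fst w, i) \<in> F" by (auto simp: line_def)
  obtain E1 where "E1 \<in> linear_system F D" "0 < E1 w"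
    using rank wF(1) by (auto simp: positive_rank_def)
  then obtain S E' where S: "S \<subseteq> F" "S \<noteq> {}" "w \<notin> S" "E' \<in> linear_system F D"
    "legal_firing F S E E'"
    using legal_firing_towards[OF fin E(1) _ wF(1) w(2)] by blast
  obtain j where j: "j \<in> {1..x}" "poor E (line F fst j)" using poor_col[OF E(1)] by blast
  note shrink = poor_rows_shrink[OF assms(1,2) S(5) i(1) poor_i w(1) S(3) j]
  have "rows E' \<subseteq> rows E" using shrink(2) by (simp add: rows_def)
  moreover have "finite (rows E)" by (simp add: rows_def)
  \<comment> \<open>The set can only shrink, and its size is already minimal, so \<open>E'\<close>
    is again a competitor.\<close>
  ultimately have "rows E' = rows E"
    using E0(2)[OF S(4)] E(2) by (metis card_seteq)
  then have "nat (?phi E) \<le> nat (?phi E')" using least[of E'] S(4) E(2) by simp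
  moreover have "?phi E' < ?phi E"
    using row_potential_decreases[OF assms(1) wF(2) S(5,1,2) shrink(1)] .
  \<comment> \<open>Minimisation was over \<open>nat\<close>; nonnegativity ensures that truncation
    does not hide the strict decrease.\<close>
  moreover have "0 \<le> ?phi E'"
    using S(4) by (intro sum_nonneg mult_nonneg_nonneg)
      (auto simp: linear_system_def effective_def row_potential_def)
  ultimately show False by linarith
qed

end
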